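(* Let $m\ge n$, $p+q=m$, $A\in\mathbb{R}^{m\times n}$, $b\in\mathbb{R}^m$, $B\in\mathbb{R}^{s\times n}$, $d\in\mathbb{R}^s$, let $y\in\mathbb{R}^n$ be a computed solution of the equality constrained indefinite least squares problem with these data, and let $\theta_1,\theta_2,\theta_3>0$. Put $r_y=b-Ay$ and suppose $r_y\neq 0$. Let $\mu_{\tt ILSE}$, $\tau_0$ and $\rho$ be the normwise backward error of $y$, the constant, and the linearized estimate defined in the context. If $$4\tau_0\,\rho\,\sqrt{\theta_1^{-2}+\|y\|_2^2}<1,$$ then $$\mu_{\tt ILSE}<2\rho .$$
   Context: The equality constrained indefinite least squares problem (ILSE) is $\min_x (b-Ax)^\top\Sigma_{pq}(b-Ax)$ subject to $Bx=d$, where $\Sigma_{pq}=\begin{pmatrix}I_p&0\\0&-I_q\end{pmatrix}$, $p+q=m$. It is assumed that $\mathrm{rank}(B)=s$ and $x^\top(A^\top\Sigma_{pq}A)x>0$ for all nonzero $x$ in the null space of $B$; then the ILSE has a unique solution $x$, determined by the normal equations $$A^\top\Sigma_{pq}(b-Ax)=B^\top\xi,\qquad Bx=d,$$ where $\xi\in\mathbb{R}^s$ is a vector of Lagrange multipliers. Notation: $\|\cdot\|_F$ is the Frobenius norm, $\|\cdot\|_2$ the spectral norm of a matrix or 2-norm of a vector, $M^\dagger$ the Moore-Penrose inverse, $\otimes$ the Kronecker product, $I_k$ the $k\times k$ identity matrix. Perturbation set: $$S_{\tt ILSE}(y)=\left\{(E,f,F,g)\ \middle|\ (A+E)^\top\Sigma_{pq}\bigl(b+f-(A+E)y\bigr)=(B+F)^\top\xi,\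 (B+F)y=d+g\right\},$$ where $E\in\mathbb{R}^{m\times n}$, $f\in\mathbb{R}^m$, $F\in\mathbb{R}^{s\times n}$, $g\in\mathbb{R}^s$ are perturbations of $A,b,B,d$, and $\xi$ is the vector given in the normal equations above. Normwise backward error: $$\mu_{\tt ILSE}=\min_{(E,f,F,g)\in S_{\tt ILSE}(y)}\left\|\begin{bmatrix}E&\theta_1 f\\ \theta_2F&\theta_3 g\end{bmatrix}\right\|_F .$$ For an arbitrary $\xi\in\mathbb{R}^s$ (here a free variable) let $$J(\xi)=\begin{bmatrix}I_n\otimes(r_y^\top\Sigma_{pq})-A^\top\Sigma_{pq}(y^\top\otimes I_m)&\theta_1^{-1}A^\top\Sigma_{pq}&-\theta_2^{-1}(I_n\otimes\xi^\top)&0\\0&0&\theta_2^{-1}(y^\top\otimes I_s)&-\theta_3^{-1}I_s\end{bmatrix},$$ $$\rho(\xi)=\left\|J(\xi)^\dagger\begin{bmatrix}B^\top\xi-A^\top\Sigma_{pq}r_y\\ d-By\end{bmatrix}\right\|_2,\qquad \rho=\min_{\xi\in\mathbb{R}^s}\rho(\xi),$$ $$\tau_0=\left\|\begin{bmatrix}I_n\otimes(r_y^\top\Sigma_{pq})-A^\top\Sigma_{pq}(y^\top\otimes I_m)&\theta_1^{-1}A^\top\Sigma_{pq}&0\\0&0&-\theta_3^{-1}I_s\end{bmatrix}^\dagger\right\|_2 .$$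
   Formalization: In the perturbation set, ξ is any multiplier vector of the perturbed normal equations, not the fixed one of the original problem, and y is assumed not to be the exact solution; otherwise the claim fails. *)

theory Defs
  imports "HOL-Analysis.Analysis"
begin

text \<open>
  Conventions. An \<open>m \<times> n\<close> real matrix has type \<open>real^'n^'m\<close>; its \<open>norm\<close> is the Frobenius
  norm, while \<open>onorm ((*v) M)\<close> is the spectral norm of \<open>M\<close>. Block matrices are indexed by sum
  types and Kronecker products by product types; column \<open>(j, i)\<close> of the index type
  \<open>'n \<times> 'm\<close> corresponds to entry \<open>(i, j)\<close> of an \<open>m \<times> n\<close> matrix stacked column by column.
\<close>

text \<open>Since a matrix is a vector of rows, \<open>u /// v\<close> both concatenates vectors and stacks
  matrices.\<close>

definition stack :: "'a^'k \<Rightarrow> 'a^'l \<Rightarrow> 'a^('k + 'l)" (infixr "'/'/'/" 55) where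
  "u /// v = (\<chi> i. case i of Inl k \<Rightarrow> u $ k | Inr l \<Rightarrow> v $ l)"

definition adjoin :: "'a^'k^'r \<Rightarrow> 'a^'l^'r \<Rightarrow> 'a^('k + 'l)^'r" (infixr "|||" 60) where
  "M ||| N = (\<chi> i. M $ i /// N $ i)"

definition kronecker ::
  "real^'c1^'r1 \<Rightarrow> real^'c2^'r2 \<Rightarrow> real^('c1 \<times> 'c2)^('r1 \<times> 'r2)" (infixl "\<otimes>" 75) where
  "M \<otimes> N = (\<chi> i j. M $ fst i $ fst j * N $ snd i $ snd j)"

text \<open>The identifications of the row indices \<open>r \<cdot> 1\<close> and \<open>1 \<cdot> r\<close> with \<open>r\<close>.\<close>

definition drop_unit_right :: "real^'c^('r \<times> 1) \<Rightarrow> real^'c^'r" where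
  "drop_unit_right M = (\<chi> i. M $ (i, 1))"

definition drop_unit_left :: "real^'c^(1 \<times> 'r) \<Rightarrow> real^'c^'r" where
  "drop_unit_left M = (\<chi> i. M $ (1, i))"

text \<open>The Moore-Penrose inverse, as the matrix satisfying the four Penrose equations.\<close>

definition is_pinv :: "real^'n^'m \<Rightarrow> real^'m^'n \<Rightarrow> bool" where
  "is_pinv M X \<longleftrightarrow>
     M ** X ** M = M \<and> X ** M ** X = X \<and>
     transpose (M ** X) = M ** X \<and> transpose (X ** M) = X ** M"

definition pinv :: "real^'n^'m \<Rightarrow> real^'m^'n" where
  "pinv M = (THE X. is_pinv M X)"

text \<open>The index type of the rows of \<open>A\<close> is linearly ordered, so that it makes sense to speak of
  its first \<open>p\<close> and its following \<open>q\<close> elements; both \<open>p = 0\<close> and \<open>q = 0\<close> are possible.\<close>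

definition Sigma_pq :: "nat \<Rightarrow> nat \<Rightarrow> real^('m::{finite,linorder})^('m::_)" where
  "Sigma_pq p q = (\<chi> i j.
     if i \<noteq> j then 0
     else if card {k. k < i} < p then 1
     else if card {k. k < i} < p + q then - 1
     else 0)"

definition ilse_objective ::
  "nat \<Rightarrow> nat \<Rightarrow> real^'n^('m::{finite,linorder}) \<Rightarrow> real^('m::_) \<Rightarrow> real^'n \<Rightarrow> real" where
  "ilse_objective p q A b x = (b - A *v x) \<bullet> (Sigma_pq p q *v (b - A *v x))"

definition is_ilse_solution ::
  "nat \<Rightarrow> nat \<Rightarrow> real^'n^('m::{finite,linorder}) \<Rightarrow> real^('m::_) \<Rightarrow> real^'n^'s \<Rightarrow> real^'s \<Rightarrow> real^'n \<Rightarrow> bool"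
where
  "is_ilse_solution p q A b B d x \<longleftrightarrow>
     B *v x = d \<and>
     (\<forall>z. B *v z = d \<longrightarrow> ilse_objective p q A b x \<le> ilse_objective p q A b z)"

definition ilse_normal_equations ::
  "nat \<Rightarrow> nat \<Rightarrow> real^'n^('m::{finite,linorder}) \<Rightarrow> real^('m::_) \<Rightarrow> real^'n^'s \<Rightarrow> real^'s
     \<Rightarrow> real^'n \<Rightarrow> real^'s \<Rightarrow> bool"
where
  "ilse_normal_equations p q A b B d x \<xi> \<longleftrightarrow>
     transpose A *v (Sigma_pq p q *v (b - A *v x)) = transpose B *v \<xi> \<and> B *v x = d"

text \<open>The multiplier vector \<open>\<xi>\<close> is that of the normal equations of the perturbed problem: it is
  not a datum, and it varies with the perturbation.\<close>

definition S_ILSE ::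
  "nat \<Rightarrow> nat \<Rightarrow> real^'n^('m::{finite,linorder}) \<Rightarrow> real^('m::_) \<Rightarrow> real^'n^'s \<Rightarrow> real^'s \<Rightarrow> real^'n
     \<Rightarrow> ((real^'n^('m::_)) \<times> (real^('m::_)) \<times> (real^'n^'s) \<times> (real^'s)) set"
where
  "S_ILSE p q A b B d y =
     {(E, f, F, g). \<exists>\<xi>. ilse_normal_equations p q (A + E) (b + f) (B + F) (d + g) y \<xi>}"

text \<open>The minima below are written as infima of nonempty sets of nonnegative reals; the
  perturbation \<open>(-A, -b, -B, -d)\<close> always belongs to \<open>S_ILSE\<close>.\<close>

definition mu_ILSE ::
  "nat \<Rightarrow> nat \<Rightarrow> real \<Rightarrow> real \<Rightarrow> real
     \<Rightarrow> real^'n^('m::{finite,linorder}) \<Rightarrow> real^('m::_) \<Rightarrow> real^'n^'s \<Rightarrow> real^'s \<Rightarrow> real^'n \<Rightarrow> real"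
where
  "mu_ILSE p q \<theta>1 \<theta>2 \<theta>3 A b B d y =
     (INF (E, f, F, g) \<in> S_ILSE p q A b B d y.
        norm ((E ||| (columnvector (\<theta>1 *\<^sub>R f) :: real^1^('m::_))) ///
              (\<theta>2 *\<^sub>R F ||| (columnvector (\<theta>3 *\<^sub>R g) :: real^1^'s))))"

definition residual_block ::
  "nat \<Rightarrow> nat \<Rightarrow> real^'n^('m::{finite,linorder}) \<Rightarrow> real^('m::_) \<Rightarrow> real^'n \<Rightarrow> real^('n \<times> 'm)^'n"
where
  "residual_block p q A b y =
     drop_unit_right ((mat 1 :: real^'n^'n) \<otimes> ((rowvector (b - A *v y) :: real^('m::_)^1) ** Sigma_pq p q))
     - transpose A ** Sigma_pq p q **
         drop_unit_left ((rowvector y :: real^'n^1) \<otimes> (mat 1 :: real^('m::_)^('m::_)))"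

definition J_ILSE ::
  "nat \<Rightarrow> nat \<Rightarrow> real \<Rightarrow> real \<Rightarrow> real
     \<Rightarrow> real^'n^('m::{finite,linorder}) \<Rightarrow> real^('m::_) \<Rightarrow> real^'n \<Rightarrow> real^'s
     \<Rightarrow> real^(('n \<times> 'm) + 'm + ('n \<times> 's) + 's)^('n + 's)"
where
  "J_ILSE p q \<theta>1 \<theta>2 \<theta>3 A b y \<xi> =
     (residual_block p q A b y
        ||| inverse \<theta>1 *\<^sub>R (transpose A ** Sigma_pq p q)
        ||| - (inverse \<theta>2 *\<^sub>R
                 drop_unit_right ((mat 1 :: real^'n^'n) \<otimes> (rowvector \<xi> :: real^'s^1)))
        ||| 0)
     ///
     (0
        ||| 0
        ||| inverse \<theta>2 *\<^sub>R drop_unit_left ((rowvector y :: real^'n^1) \<otimes> (mat 1 :: real^'s^'s))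
        ||| - (inverse \<theta>3 *\<^sub>R mat 1))"

definition rho_at ::
  "nat \<Rightarrow> nat \<Rightarrow> real \<Rightarrow> real \<Rightarrow> real
     \<Rightarrow> real^'n^('m::{finite,linorder}) \<Rightarrow> real^('m::_) \<Rightarrow> real^'n^'s \<Rightarrow> real^'s \<Rightarrow> real^'n \<Rightarrow> real^'s \<Rightarrow> real"
where
  "rho_at p q \<theta>1 \<theta>2 \<theta>3 A b B d y \<xi> =
     norm (pinv (J_ILSE p q \<theta>1 \<theta>2 \<theta>3 A b y \<xi>) *v
       ((transpose B *v \<xi> - transpose A *v (Sigma_pq p q *v (b - A *v y))) /// (d - B *v y)))"

definition rho_ILSE ::
  "nat \<Rightarrow> nat \<Rightarrow> real \<Rightarrow> real \<Rightarrow> real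
     \<Rightarrow> real^'n^('m::{finite,linorder}) \<Rightarrow> real^('m::_) \<Rightarrow> real^'n^'s \<Rightarrow> real^'s \<Rightarrow> real^'n \<Rightarrow> real"
where
  "rho_ILSE p q \<theta>1 \<theta>2 \<theta>3 A b B d y = (INF \<xi>. rho_at p q \<theta>1 \<theta>2 \<theta>3 A b B d y \<xi>)"

text \<open>The number of constraints enters \<open>\<tau>\<^sub>0\<close> only through the size of \<open>I\<^sub>s\<close>, hence the type
  argument.\<close>

definition tau0_ILSE ::
  "'s::finite itself \<Rightarrow> nat \<Rightarrow> nat \<Rightarrow> real \<Rightarrow> real
     \<Rightarrow> real^'n^('m::{finite,linorder}) \<Rightarrow> real^('m::_) \<Rightarrow> real^'n \<Rightarrow> real"
where
  "tau0_ILSE _ p q \<theta>1 \<theta>3 A b y =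
     onorm ((*v) (pinv (
       (residual_block p q A b y ||| inverse \<theta>1 *\<^sub>R (transpose A ** Sigma_pq p q) ||| 0)
       ///
       (0 ||| 0 ||| - (inverse \<theta>3 *\<^sub>R (mat 1 :: real^'s^'s))))))"

end

(*
  Write S for Sigma_pq, r = b - A y, and w for the scaled vectorization of (E, f, F, g).
  The perturbed normal equations read J(\<xi>) w + N w = h, where h is the right-hand side in
  the definition of \<rho>(\<xi>) and N w = (E^T S (f - E y), 0) is quadratic. As r is nonzero,
  J(\<xi>) is onto, so every fixed point of w |-> J(\<xi>)^+ (h - N w) is an admissible
  perturbation. Minimality of the norm of J(\<xi>)^+ z among the preimages of z bounds
  J(\<xi>)^+ by \<tau>_0, uniformly in \<xi>, so the map sends the ball of radius t into itself as
  soon as \<rho>(\<xi>) + \<tau>_0 sqrt (\<theta>_1^-2 + |y|^2) t^2 <= t, and Brouwer's theorem gives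
  \<mu> <= t. The hypothesis leaves room for some t < 2 \<rho> provided \<rho> > 0. If \<rho> were 0, then
  B y = d and A^T S r would lie in the closed range of B^T, and y would be a solution.
*)
theory Submission
  imports Defs
begin


section \<open>The signature matrix and Frobenius norm estimates\<close>

lemma vector_matrix_mul_Sigma_pq: "v v* Sigma_pq p q = Sigma_pq p q *v v"
  for v :: "real^('m::{finite,linorder})"
proof -
  have "transpose (Sigma_pq p q :: real^('m::_)^('m::_)) = Sigma_pq p q"
    by (auto simp: transpose_def Sigma_pq_def vec_eq_iff)
  then show ?thesis
    using vector_transpose_matrix[of v "Sigma_pq p q"] by simp
qed

lemma inner_Sigma_pq_commute: "u \<bullet> (Sigma_pq p q *v v) = (Sigma_pq p q *v u) \<bullet> v"
  by (simp add: dot_lmul_matrix[symmetric] vector_matrix_mul_Sigma_pq)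

text \<open>An index has fewer than \<open>CARD('m)\<close> predecessors, so
  \<open>p + q = CARD('m)\<close> rules out the default entry 0 on the diagonal of
  \<open>Sigma_pq\<close>. All diagonal entries are then 1 or -1, and only signs of coordinates
  change.\<close>

lemma norm_Sigma_pq_mult:
  fixes v :: "real^('m::{finite,linorder})"
  assumes "p + q = CARD('m)"
  shows "norm (Sigma_pq p q *v v) = norm v"
proof -
  have "\<bar>(Sigma_pq p q *v v) $ i\<bar> = \<bar>v $ i\<bar>" for i
  proof -
    have "card {k. k < i} < CARD('m)"
      by (rule psubset_card_mono) auto
    then have s: "\<bar>Sigma_pq p q $ i $ i :: real\<bar> = 1"
      using assms by (auto simp: Sigma_pq_def)
    have "(Sigma_pq p q *v v) $ i = (\<Sum>j\<in>UNIV. if j = i then Sigma_pq p q $ i $ i * v $ i else 0)"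
      unfolding matrix_vector_mult_def
      by (simp only: vec_lambda_beta, rule sum.cong) (auto simp: Sigma_pq_def)
    then show ?thesis
      by (simp add: abs_mult s)
  qed
  then show ?thesis
    by (simp add: norm_vec_def L2_set_def)
qed

lemma norm_matrix_vector_mult_le: "norm (M *v v) \<le> norm M * norm v"
  for M :: "real^'n^'m"
proof -
  have "norm (M *v v) = L2_set (\<lambda>i. norm ((M *v v) $ i)) UNIV"
    by (simp add: norm_vec_def)
  also have "\<dots> \<le> L2_set (\<lambda>i. norm v * norm (M $ i)) UNIV"
    by (intro L2_set_mono)
      (auto simp: matrix_vector_mul_component mult.commute[of "norm v"] Cauchy_Schwarz_ineq2)
  also have "\<dots> = norm M * norm v"
    by (simp add: L2_set_right_distrib[symmetric] norm_vec_def[of M] mult.commute)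
  finally show ?thesis .
qed

lemma norm_transpose: "norm (transpose M) = norm M" for M :: "real^'n^'m"
proof -
  have "(norm (transpose M))\<^sup>2 = (norm M)\<^sup>2"
    unfolding power2_norm_eq_inner inner_vec_def transpose_def
    by simp (rule sum.swap)
  then show ?thesis by simp
qed

lemma norm_vector_matrix_mult_le: "norm (v v* M) \<le> norm M * norm v"
  for M :: "real^'n^'m"
  using norm_matrix_vector_mult_le[of "transpose M" v] by (simp add: norm_transpose)

subsection \<open>Block matrices\<close>

text \<open>Since \<open>///\<close> and \<open>|||\<close> associate to the right, an inner block
  is reached by a chain \<open>upper (lower ...)\<close> and the last one by \<open>lower\<close>
  alone.\<close>

definition upper :: "'a^('k::finite + 'l::finite) \<Rightarrow> 'a^'k" where
  "upper w = (\<chi> i. w $ Inl i)"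

definition lower :: "'a^('k::finite + 'l::finite) \<Rightarrow> 'a^'l" where
  "lower w = (\<chi> i. w $ Inr i)"

lemma upper_stack [simp]: "upper (u /// v) = u"
  and lower_stack [simp]: "lower (u /// v) = v"
  by (simp_all add: upper_def lower_def stack_def)

lemma stack_upper_lower [simp]: "upper w /// lower w = w"
  by (simp add: upper_def lower_def stack_def vec_eq_iff split: sum.split)

lemma upper_plus [simp]: "upper (u + v) = upper u + upper v"
  and lower_plus [simp]: "lower (u + v) = lower u + lower v"
  by (simp_all add: upper_def lower_def vec_eq_iff)

lemma sum_UNIV_Plus:
  "sum f (UNIV :: ('a::finite + 'b::finite) set) = (\<Sum>i\<in>UNIV. f (Inl i)) + (\<Sum>i\<in>UNIV. f (Inr i))"
  by (simp add: UNIV_Plus_UNIV[symmetric] sum.Plus del: UNIV_Plus_UNIV)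

lemma stack_mult: "(M /// N) *v w = (M *v w) /// (N *v w)"
  by (simp add: matrix_vector_mult_def stack_def vec_eq_iff split: sum.split)

lemma adjoin_mult: "(M ||| N) *v w = M *v upper w + N *v lower w"
  by (simp add: matrix_vector_mult_def adjoin_def stack_def upper_def lower_def
      vec_eq_iff sum_UNIV_Plus)

lemma norm_stack: "(norm (u /// v))\<^sup>2 = (norm u)\<^sup>2 + (norm v)\<^sup>2"
  for u :: "'a::real_normed_vector^'k" and v :: "'a^'l"
  by (simp add: norm_vec_def L2_set_def sum_nonneg sum_UNIV_Plus stack_def)

lemma norm_adjoin: "(norm (M ||| N))\<^sup>2 = (norm M)\<^sup>2 + (norm N)\<^sup>2"
  for M :: "'a::real_normed_vector^'k^'r" and N :: "'a^'l^'r"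
proof -
  have *: "(norm v)\<^sup>2 = (\<Sum>i\<in>UNIV. (norm (v $ i))\<^sup>2)" for v :: "'b::real_normed_vector^'s"
    by (simp add: norm_vec_def L2_set_def sum_nonneg)
  show ?thesis
    unfolding *[of "M ||| N"] *[of M] *[of N]
    by (simp add: adjoin_def norm_stack sum.distrib)
qed

lemma norm_columnvector: "norm (columnvector v :: real^1^'m) = norm v"
  by (simp add: norm_vec_def columnvector_def)

section \<open>Column-wise vectorization of matrices\<close>

definition unvectorize :: "'a^('n::finite \<times> 'm::finite) \<Rightarrow> 'a^'n^'m" where
  "unvectorize w = (\<chi> i j. w $ (j, i))"

definition vectorize :: "'a^'n^'m \<Rightarrow> 'a^('n::finite \<times> 'm::finite)" where
  "vectorize M = (\<chi> k. M $ snd k $ fst k)"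

lemma unvectorize_vectorize [simp]: "unvectorize (vectorize M) = M"
  by (simp add: unvectorize_def vectorize_def vec_eq_iff)

lemma unvectorize_0 [simp]: "unvectorize 0 = 0"
  by (simp add: unvectorize_def vec_eq_iff)

lemma sum_UNIV_Times:
  "sum f (UNIV :: ('a::finite \<times> 'b::finite) set) = (\<Sum>i\<in>UNIV. \<Sum>j\<in>UNIV. f (i, j))"
  by (simp add: UNIV_Times_UNIV[symmetric] sum.cartesian_product del: UNIV_Times_UNIV)

lemma norm_unvectorize [simp]: "norm (unvectorize w) = norm w"
  for w :: "real^('n::finite \<times> 'm::finite)"
proof -
  have "(norm (unvectorize w))\<^sup>2 = (norm w)\<^sup>2"
    unfolding power2_norm_eq_inner inner_vec_def unvectorize_def
    by (simp add: sum_UNIV_Times) (rule sum.swap)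
  then show ?thesis by simp
qed

lemma norm_upper_le: "norm (upper w) \<le> norm w"
  and norm_lower_le: "norm (lower w) \<le> norm w"
  for w :: "'a::real_normed_vector^('k::finite + 'l::finite)"
  using norm_stack[of "upper w" "lower w"] by (simp_all add: power2_le_imp_le)

section \<open>Continuity rules for the fixed-point map\<close>

lemma continuous_on_stack [continuous_intros]:
  assumes "continuous_on S f" "continuous_on S g"
  shows "continuous_on S (\<lambda>x. f x /// g x)"
  unfolding stack_def
proof (rule continuous_on_vec_lambda)
  show "continuous_on S (\<lambda>x. case i of Inl k \<Rightarrow> f x $ k | Inr l \<Rightarrow> g x $ l)" for i
    by (cases i) (auto intro!: continuous_intros assms)
qed

lemma continuous_on_upper [continuous_intros]:
  "continuous_on S f \<Longrightarrow> continuous_on S (\<lambda>x. upper (f x))"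
  and continuous_on_lower [continuous_intros]:
  "continuous_on S g \<Longrightarrow> continuous_on S (\<lambda>x. lower (g x))"
  unfolding upper_def lower_def by (auto intro!: continuous_intros)

lemma continuous_on_unvectorize [continuous_intros]:
  "continuous_on S f \<Longrightarrow> continuous_on S (\<lambda>x. unvectorize (f x))"
  unfolding unvectorize_def by (auto intro!: continuous_intros)

lemma continuous_on_matrix_vector_mult [continuous_intros]:
  fixes M :: "'a::topological_space \<Rightarrow> real^'n^'m"
  assumes "continuous_on S M" "continuous_on S v"
  shows "continuous_on S (\<lambda>x. M x *v v x)"
  unfolding matrix_vector_mult_def by (intro continuous_intros assms)

lemma continuous_on_vector_matrix_mult [continuous_intros]:
  fixes M :: "'a::topological_space \<Rightarrow> real^'n^'m"
  assumes "continuous_on S M" "continuous_on S v"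
  shows "continuous_on S (\<lambda>x. v x v* M x)"
  unfolding vector_matrix_mult_def by (intro continuous_intros assms)

section \<open>Kronecker products acting on vectorized matrices\<close>

text \<open>An instance of the identity vec(L X R) = (R^T \<otimes> L) vec X, here with R the
  identity; the next lemma is the instance with L the identity.\<close>

lemma kronecker_mat1_rowvector_mult:
  fixes v :: "real^'m" and w :: "real^('n::finite \<times> 'm::finite)" and R :: "real^'m^1"
  shows "drop_unit_right ((mat 1 :: real^'n^'n) \<otimes> R) *v w = R $ 1 v* unvectorize w"
proof -
  have "(\<Sum>i\<in>UNIV. \<Sum>j\<in>UNIV. mat 1 $ k $ i * R $ 1 $ j * w $ (i, j)) =
      (\<Sum>i\<in>UNIV. if k = i then \<Sum>j\<in>UNIV. R $ 1 $ j * w $ (i, j) else 0)" for k :: 'n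
    by (rule sum.cong) (auto simp: mat_def)
  then show ?thesis
    by (simp add: vec_eq_iff matrix_vector_mult_def vector_matrix_mult_def drop_unit_right_def
        kronecker_def unvectorize_def sum_UNIV_Times mult.commute)
qed

lemma kronecker_rowvector_mat1_mult:
  fixes y :: "real^'n" and w :: "real^('n::finite \<times> 'm::finite)"
  shows "drop_unit_left ((rowvector y :: real^'n^1) \<otimes> (mat 1 :: real^'m^'m)) *v w =
    unvectorize w *v y"
proof -
  have "(\<Sum>j\<in>UNIV. y $ i * mat 1 $ k $ j * w $ (i, j)) =
      (\<Sum>j\<in>UNIV. if k = j then y $ i * w $ (i, j) else 0)" for i and k :: 'm
    by (rule sum.cong) (auto simp: mat_def)
  then show ?thesis
    by (simp add: vec_eq_iff matrix_vector_mult_def drop_unit_left_def rowvector_def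
        kronecker_def unvectorize_def sum_UNIV_Times mult.commute)
qed

subsection \<open>The Moore-Penrose inverse of a surjective matrix\<close>

text \<open>Both \<open>M ** X\<close> and \<open>M ** Y\<close> are the orthogonal projection onto
  the range of \<open>M\<close>, and \<open>X ** M\<close> and \<open>Y ** M\<close> agree in the
  same way. Then X = X M X = Y M Y = Y.\<close>

lemma is_pinv_unique:
  assumes X: "is_pinv M X" and Y: "is_pinv M Y"
  shows "X = Y"
proof -
  have "M ** X = (M ** Y) ** (M ** X)"
    using Y by (simp add: is_pinv_def matrix_mul_assoc)
  also have "\<dots> = transpose ((M ** X) ** (M ** Y))"
    using X Y by (simp only: is_pinv_def matrix_transpose_mul[of "M ** X"])
  also have "\<dots> = M ** Y"
    using X Y by (simp only: is_pinv_def matrix_mul_assoc)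
  finally have MX: "M ** X = M ** Y" .
  have "X ** M = (X ** M) ** (Y ** M)"
    using Y by (metis is_pinv_def matrix_mul_assoc)
  also have "\<dots> = transpose ((Y ** M) ** (X ** M))"
    using X Y by (simp only: is_pinv_def matrix_transpose_mul[of "Y ** M"])
  also have "\<dots> = Y ** M"
    using X Y by (metis is_pinv_def matrix_mul_assoc)
  finally have XM: "X ** M = Y ** M" .
  have "X = X ** (M ** X)"
    using X by (simp add: is_pinv_def matrix_mul_assoc)
  also have "\<dots> = Y ** M ** Y"
    by (simp add: MX XM matrix_mul_assoc)
  also have "\<dots> = Y"
    using Y by (simp add: is_pinv_def)
  finally show ?thesis .
qed

text \<open>For surjective \<open>M\<close> the Gram matrix M M^T is invertible, and M^T (M M^T)^-1
  satisfies the Penrose equations. With uniqueness this makes the \<open>THE\<close> in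
  \<open>pinv\<close> meaningful.\<close>

lemma is_pinv_pinv:
  fixes M :: "real^'n^'m"
  assumes "surj ((*v) M)"
  shows "is_pinv M (pinv M)"
proof -
  obtain R where R: "M ** R = mat 1"
    using assms matrix_right_invertible_surjective by blast
  define G where "G = M ** transpose M"
  \<comment> \<open>G v = 0 forces |M^T v|^2 = 0, and M^T is injective because the transpose of the
    right inverse \<open>R\<close> is a left inverse of it.\<close>
  have "v = 0" if "G *v v = 0" for v
  proof -
    have "(transpose M *v v) \<bullet> (transpose M *v v) = v \<bullet> (G *v v)"
      by (metis G_def dot_lmul_matrix matrix_vector_mul_assoc transpose_matrix_vector)
    then have "transpose M *v v = 0"
      using that by simp
    then have "transpose R *v (transpose M *v v) = 0"
      by (simp del: transpose_matrix_vector)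
    moreover have "transpose R ** transpose M = mat 1"
      using R by (metis matrix_transpose_mul transpose_mat)
    ultimately show "v = 0"
      by (metis matrix_vector_mul_assoc matrix_vector_mul_lid)
  qed
  then obtain H where H: "H ** G = mat 1"
    using matrix_left_invertible_ker by blast
  then have GH: "G ** H = mat 1"
    using matrix_left_right_inverse by blast
  have "transpose G = G"
    by (simp add: G_def matrix_transpose_mul)
  then have "transpose H = H"
    using GH H by (metis matrix_mul_assoc matrix_mul_lid matrix_mul_rid matrix_transpose_mul transpose_mat)
  have MX: "M ** (transpose M ** H) = mat 1"
    using GH by (simp add: G_def matrix_mul_assoc)
  have "is_pinv M (transpose M ** H)"
    unfolding is_pinv_def MX
    by (simp add: MX matrix_transpose_mul \<open>transpose H = H\<close> matrix_mul_assoc[symmetric])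
  then show ?thesis
    unfolding pinv_def by (metis is_pinv_unique theI')
qed

lemma mult_pinv_mult:
  fixes M :: "real^'n^'m"
  assumes "surj ((*v) M)"
  shows "M *v (pinv M *v v) = v"
proof -
  obtain w where "v = M *v w"
    using assms by blast
  then show ?thesis
    using is_pinv_pinv[OF assms] by (simp add: is_pinv_def matrix_vector_mul_assoc matrix_mul_assoc)
qed

text \<open>Among all preimages, the one picked by the Moore-Penrose inverse has minimal norm, because
  \<open>pinv M ** M\<close> is an orthogonal projection.\<close>

lemma norm_pinv_mult_le:
  fixes M :: "real^'n^'m"
  assumes "surj ((*v) M)"
  shows "norm (pinv M *v (M *v w)) \<le> norm w"
proof -
  define P where "P = pinv M ** M"
  have P: "transpose P = P" "P ** P = P"
    using is_pinv_pinv[OF assms] by (simp_all add: P_def is_pinv_def matrix_mul_assoc)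
  have "(P *v w) \<bullet> (P *v w) = w \<bullet> (P *v w)"
    using P by (metis dot_lmul_matrix matrix_vector_mul_assoc vector_transpose_matrix)
  also have "\<dots> \<le> norm w * norm (P *v w)"
    by (rule norm_cauchy_schwarz)
  finally have "norm (P *v w) * norm (P *v w) \<le> norm w * norm (P *v w)"
    by (simp add: norm_eq_sqrt_inner)
  then have "norm (P *v w) \<le> norm w"
    by (cases "norm (P *v w) = 0") (auto simp: mult_le_cancel_right)
  then show ?thesis
    by (simp add: P_def matrix_vector_mul_assoc)
qed


subsection \<open>The linearised normal equations\<close>

lemmas vector_matrix_mult_simps =
  vector_matrix_left_distrib vector_matrix_mult_diff_distrib
  vector_matrix_mult_add_rdistrib vector_matrix_mult_diff_rdistrib
  scaleR_vector_matrix_assoc vector_scaleR_matrix_ac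

lemma matrix_uminus_mult: "(- M) *v v = - (M *v v)" for M :: "real^'n^'m"
  by (simp add: vec_eq_iff matrix_vector_mult_def sum_negf)

lemma rowvector_nth: "rowvector v $ i = v"
  by (simp add: vec_eq_iff rowvector_def)

lemma rowvector_mult_nth: "(rowvector v ** M) $ 1 = v v* M" for M :: "real^'n^'m"
  by (simp add: vec_eq_iff matrix_matrix_mult_def vector_matrix_mult_def rowvector_def)

text \<open>This is the derivative of (A + E)^T S (b - (A + E) y) in \<open>E\<close> at 0, with S =
  \<open>Sigma_pq p q\<close>. Transposed products appear in the form \<open>v v* M\<close>, into
  which the simplifier turns \<open>transpose M *v v\<close>.\<close>

lemma residual_block_mult:
  "residual_block p q A b y *v w =
    (Sigma_pq p q *v (b - A *v y)) v* unvectorize w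
    - (Sigma_pq p q *v (unvectorize w *v y)) v* A"
  by (simp add: residual_block_def matrix_vector_mult_diff_rdistrib kronecker_mat1_rowvector_mult
      rowvector_mult_nth vector_matrix_mul_Sigma_pq kronecker_rowvector_mat1_mult
      matrix_vector_mul_assoc[symmetric])

text \<open>With the blocks of \<open>w\<close> read as E, \<theta>1 f, \<theta>2 F and \<theta>3 g,
  the two block rows are the parts of the perturbed normal equations that are linear in the
  perturbation, for fixed \<xi>.\<close>

lemma J_ILSE_mult:
  fixes w :: "real^(('n::finite \<times> 'm::{finite,linorder}) + 'm + ('n \<times> 's::finite) + 's)"
  shows "J_ILSE p q \<theta>1 \<theta>2 \<theta>3 A b y \<xi> *v w =
    (let E = unvectorize (upper w); u = upper (lower w);
         F = unvectorize (upper (lower (lower w))); v = lower (lower (lower w))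
     in ((Sigma_pq p q *v (b - A *v y)) v* E - (Sigma_pq p q *v (E *v y)) v* A
          + inverse \<theta>1 *\<^sub>R ((Sigma_pq p q *v u) v* A) - inverse \<theta>2 *\<^sub>R (\<xi> v* F))
        /// (inverse \<theta>2 *\<^sub>R (F *v y) - inverse \<theta>3 *\<^sub>R v))"
  by (simp add: J_ILSE_def Let_def stack_mult adjoin_mult residual_block_mult
      kronecker_mat1_rowvector_mult kronecker_rowvector_mat1_mult matrix_uminus_mult
      scaleR_matrix_vector_assoc[symmetric] matrix_vector_mul_assoc[symmetric] rowvector_nth
      add_diff_eq)

text \<open>\<open>J_ILSE\<close> without the block column of \<open>F\<close>, the only one in
  which \<xi> occurs. The constant \<open>tau0_ILSE\<close> is the spectral norm of its
  Moore-Penrose inverse.\<close>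

definition tau_matrix ::
  "nat \<Rightarrow> nat \<Rightarrow> real \<Rightarrow> real
     \<Rightarrow> real^'n^('m::{finite,linorder}) \<Rightarrow> real^('m::_) \<Rightarrow> real^'n
     \<Rightarrow> real^(('n \<times> 'm) + 'm + 's::finite)^('n + 's)"
where
  "tau_matrix p q \<theta>1 \<theta>3 A b y =
     (residual_block p q A b y ||| inverse \<theta>1 *\<^sub>R (transpose A ** Sigma_pq p q) ||| 0)
     /// (0 ||| 0 ||| - (inverse \<theta>3 *\<^sub>R mat 1))"

lemma tau_matrix_mult:
  fixes w :: "real^(('n::finite \<times> 'm::{finite,linorder}) + 'm + 's::finite)"
  shows "tau_matrix p q \<theta>1 \<theta>3 A b y *v w =
    (let E = unvectorize (upper w); u = upper (lower w); v = lower (lower w)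
     in ((Sigma_pq p q *v (b - A *v y)) v* E - (Sigma_pq p q *v (E *v y)) v* A
          + inverse \<theta>1 *\<^sub>R ((Sigma_pq p q *v u) v* A))
        /// (- (inverse \<theta>3 *\<^sub>R v)))"
  by (simp add: tau_matrix_def Let_def stack_mult adjoin_mult residual_block_mult matrix_uminus_mult
      scaleR_matrix_vector_assoc[symmetric] matrix_vector_mul_assoc[symmetric])

text \<open>Given a target \<open>(c, v)\<close>, the rank-one \<open>E\<close> with \<open>E\<^sup>T \<Sigma> r = c\<close> and \<open>f = E y\<close> solve the first
  block row, because \<open>f - E y\<close> vanishes.\<close>

lemma surj_tau_matrix:
  fixes A :: "real^'n^('m::{finite,linorder})" and b :: "real^('m::_)"
  assumes "p + q = CARD('m)" and "\<theta>1 > 0" and "\<theta>3 > 0" and "b - A *v y \<noteq> 0"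
  shows "surj ((*v) (tau_matrix p q \<theta>1 \<theta>3 A b y :: real^(('n \<times> 'm) + 'm + 's::finite)^('n + 's)))"
    (is "surj ((*v) ?T)")
proof -
  \<comment> \<open>Here \<open>r\<close> is the signed residual; it is nonzero because
    \<open>Sigma_pq\<close> preserves norms.\<close>
  define r where "r = Sigma_pq p q *v (b - A *v y)"
  have "norm r \<noteq> 0"
    using assms by (simp add: r_def norm_Sigma_pq_mult)
  have "z \<in> range ((*v) ?T)" for z
  proof -
    define E where "E = (\<chi> i j. r $ i * upper z $ j / (norm r)\<^sup>2)"
    have "(r v* E) $ j = upper z $ j" for j
    proof -
      have "(r v* E) $ j = (\<Sum>i\<in>UNIV. (r $ i * r $ i) * (upper z $ j / (norm r)\<^sup>2))"
        by (simp add: vector_matrix_mult_def E_def ac_simps)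
      also have "\<dots> = (norm r)\<^sup>2 * (upper z $ j / (norm r)\<^sup>2)"
        by (simp only: sum_distrib_right[symmetric] power2_norm_eq_inner inner_vec_def inner_real_def)
      finally show ?thesis
        using \<open>norm r \<noteq> 0\<close> by simp
    qed
    then have "r v* E = upper z"
      by (simp add: vec_eq_iff)
    then have "?T *v (vectorize E /// \<theta>1 *\<^sub>R (E *v y) /// - (\<theta>3 *\<^sub>R lower z)) = z"
      using assms by (simp add: tau_matrix_mult Let_def r_def[symmetric] matrix_vector_mult_scaleR
          vector_matrix_mult_simps)
    then show ?thesis
      by (metis rangeI)
  qed
  then show ?thesis
    by blast
qed

text \<open>A zero \<open>F\<close> block switches off the column that contains \<xi>, so preimages
  under \<open>tau_matrix\<close> become preimages under \<open>J_ILSE\<close> for every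
  \<xi>.\<close>

lemma J_ILSE_mult_padded:
  "J_ILSE p q \<theta>1 \<theta>2 \<theta>3 A b y \<xi> *v (upper w /// upper (lower w) /// 0 /// lower (lower w)) =
    tau_matrix p q \<theta>1 \<theta>3 A b y *v w"
  by (simp add: J_ILSE_mult tau_matrix_mult Let_def vector_matrix_mult_simps)

lemma surj_J_ILSE:
  fixes A :: "real^'n^('m::{finite,linorder})" and b :: "real^('m::_)" and \<xi> :: "real^'s"
  assumes "p + q = CARD('m)" and "\<theta>1 > 0" and "\<theta>3 > 0" and "b - A *v y \<noteq> 0"
  shows "surj ((*v) (J_ILSE p q \<theta>1 \<theta>2 \<theta>3 A b y \<xi>))"
proof -
  have "z \<in> range ((*v) (J_ILSE p q \<theta>1 \<theta>2 \<theta>3 A b y \<xi>))" for z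
  proof -
    obtain w where "z = tau_matrix p q \<theta>1 \<theta>3 A b y *v w"
      using surj_tau_matrix[OF assms] by blast
    then show ?thesis
      by (metis J_ILSE_mult_padded rangeI)
  qed
  then show ?thesis
    by blast
qed

text \<open>The preimage of \<open>z\<close> given by the Moore-Penrose inverse of
  \<open>tau_matrix\<close>, padded with zeros, is a preimage under \<open>J_ILSE\<close> of the
  same norm. The one chosen by \<open>pinv\<close> of \<open>J_ILSE\<close> is no longer, whatever
  \<xi> is.\<close>

lemma norm_pinv_J_ILSE_le:
  fixes A :: "real^'n^('m::{finite,linorder})" and b :: "real^('m::_)" and \<xi> :: "real^'s"
  assumes "p + q = CARD('m)" and "\<theta>1 > 0" and "\<theta>3 > 0" and "b - A *v y \<noteq> 0"
  shows "norm (pinv (J_ILSE p q \<theta>1 \<theta>2 \<theta>3 A b y \<xi>) *v z) \<le>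
    tau0_ILSE TYPE('s) p q \<theta>1 \<theta>3 A b y * norm z"
proof -
  define T where "T = (tau_matrix p q \<theta>1 \<theta>3 A b y :: real^(('n \<times> 'm) + 'm + 's)^('n + 's))"
  define w where "w = pinv T *v z"
  define w' where "w' = (upper w /// upper (lower w) /// (0 :: real^('n \<times> 's)) /// lower (lower w))"
  have "T *v w = z"
    unfolding w_def T_def by (intro mult_pinv_mult surj_tau_matrix assms)
  then have z: "J_ILSE p q \<theta>1 \<theta>2 \<theta>3 A b y \<xi> *v w' = z"
    by (simp add: w'_def T_def J_ILSE_mult_padded)
  have "norm (pinv (J_ILSE p q \<theta>1 \<theta>2 \<theta>3 A b y \<xi>) *v z) \<le> norm w'"
    unfolding z[symmetric] by (intro norm_pinv_mult_le surj_J_ILSE assms)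
  also have "norm w' = norm w"
  proof -
    have "(norm w')\<^sup>2 = (norm (upper w /// upper (lower w) /// lower (lower w)))\<^sup>2"
      unfolding w'_def norm_stack by simp
    then show ?thesis
      by simp
  qed
  also have "norm w \<le> onorm ((*v) (pinv T)) * norm z"
    unfolding w_def by (rule onorm) simp
  finally show ?thesis
    by (simp add: T_def tau0_ILSE_def tau_matrix_def)
qed

subsection \<open>From linearised solutions to perturbations\<close>

text \<open>The second-order term E^T S (f - E y), with f recovered from its scaled block. It is the
  only one: \<xi> is held fixed, so F^T \<xi> is linear in F, and the constraint row is linear in F
  and g.\<close>

definition quadratic_remainder where
  "quadratic_remainder p q \<theta> y w =
    (let E = unvectorize (upper w)
     in (Sigma_pq p q *v (inverse \<theta> *\<^sub>R upper (lower w) - E *v y)) v* E)"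

text \<open>The hypothesis is the exact perturbed system, sorted by order. Dividing the blocks of
  \<open>w\<close> by the weights gives an admissible perturbation with multiplier \<xi>, and the
  weights in the definition of \<open>mu_ILSE\<close> restore \<open>norm w\<close>.\<close>

lemma mu_ILSE_le:
  fixes w :: "real^(('n::finite \<times> 'm::{finite,linorder}) + 'm + ('n \<times> 's::finite) + 's)"
  assumes pos: "\<theta>1 > 0" "\<theta>2 > 0" "\<theta>3 > 0"
    and eq: "J_ILSE p q \<theta>1 \<theta>2 \<theta>3 A b y \<xi> *v w + (quadratic_remainder p q \<theta>1 y w /// 0) =
      (transpose B *v \<xi> - transpose A *v (Sigma_pq p q *v (b - A *v y))) /// (d - B *v y)"
  shows "mu_ILSE p q \<theta>1 \<theta>2 \<theta>3 A b B d y \<le> norm w"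
proof -
  define E where "E = unvectorize (upper w)"
  define f where "f = inverse \<theta>1 *\<^sub>R upper (lower w)"
  define F where "F = inverse \<theta>2 *\<^sub>R unvectorize (upper (lower (lower w)))"
  define g where "g = inverse \<theta>3 *\<^sub>R lower (lower (lower w))"
  define S where "S = (Sigma_pq p q :: real^('m::_)^('m::_))"
  have "(S *v (b - A *v y)) v* E - (S *v (E *v y)) v* A + (S *v f) v* A - \<xi> v* F
      + (S *v (f - E *v y)) v* E = \<xi> v* B - (S *v (b - A *v y)) v* A"
    using arg_cong[OF eq, of upper]
    by (simp add: J_ILSE_mult Let_def quadratic_remainder_def E_def f_def F_def S_def
        vector_matrix_mult_simps matrix_vector_mult_scaleR)
  moreover have "S *v (b + f - (A + E) *v y) = S *v (b - A *v y) + (S *v f - S *v (E *v y))"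
    by (simp add: algebra_simps matrix_vector_mult_add_rdistrib)
  ultimately have "(S *v (b + f - (A + E) *v y)) v* (A + E) = \<xi> v* (B + F)"
    by (simp add: vector_matrix_mult_simps matrix_vector_mult_diff_distrib algebra_simps)
  moreover have "F *v y - g = d - B *v y"
    using arg_cong[OF eq, of lower]
    by (simp add: J_ILSE_mult Let_def F_def g_def scaleR_matrix_vector_assoc)
  then have "(B + F) *v y = d + g"
    by (simp add: matrix_vector_mult_add_rdistrib algebra_simps)
  ultimately have "(E, f, F, g) \<in> S_ILSE p q A b B d y"
    by (auto simp: S_ILSE_def ilse_normal_equations_def S_def)
  then have "mu_ILSE p q \<theta>1 \<theta>2 \<theta>3 A b B d y \<le>
      norm ((E ||| (columnvector (\<theta>1 *\<^sub>R f) :: real^1^('m::_))) ///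
              (\<theta>2 *\<^sub>R F ||| (columnvector (\<theta>3 *\<^sub>R g) :: real^1^'s)))" (is "_ \<le> norm ?P")
    unfolding mu_ILSE_def by (intro cINF_lower2[where x = "(E, f, F, g)"]) (auto intro!: bdd_belowI2[where m = 0])
  also have "norm ?P = norm w"
  proof -
    have "(norm ?P)\<^sup>2 = (norm (upper w))\<^sup>2 + (norm (upper (lower w)))\<^sup>2
        + (norm (upper (lower (lower w))))\<^sup>2 + (norm (lower (lower (lower w))))\<^sup>2"
      using pos by (simp add: norm_stack norm_adjoin norm_columnvector E_def f_def F_def g_def)
    also have "\<dots> = (norm (upper w /// upper (lower w) /// upper (lower (lower w))
        /// lower (lower (lower w))))\<^sup>2"
      unfolding norm_stack by simp
    finally show ?thesis
      by simp
  qed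
  finally show ?thesis .
qed

text \<open>The square root comes from the Cauchy-Schwarz inequality in the plane for (1/\<theta>,
  |y|) and (|u|, |E|), applied to f - E y. The outer factor E contributes the second
  \<open>norm w\<close>.\<close>

lemma norm_quadratic_remainder_le:
  fixes w :: "real^(('n::finite \<times> 'm::{finite,linorder}) + 'm + 'k::finite)"
  assumes "p + q = CARD('m)" and "\<theta> > 0"
  shows "norm (quadratic_remainder p q \<theta> y w) \<le> sqrt ((inverse \<theta>)\<^sup>2 + (norm y)\<^sup>2) * (norm w)\<^sup>2"
proof -
  define E where "E = unvectorize (upper w)"
  define u where "u = upper (lower w)"
  have "norm (inverse \<theta> *\<^sub>R u - E *v y) \<le> norm (inverse \<theta> *\<^sub>R u) + norm (E *v y)"
    by (rule norm_triangle_ineq4)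
  also have "\<dots> \<le> inverse \<theta> * norm u + norm E * norm y"
    using assms norm_matrix_vector_mult_le[of E y] by simp
  also have "\<dots> = (inverse \<theta>, norm y) \<bullet> (norm u, norm E)"
    by simp
  also have "\<dots> \<le> norm (inverse \<theta>, norm y) * norm (norm u, norm E)"
    by (rule norm_cauchy_schwarz)
  also have "norm (norm u, norm E) \<le> norm w"
  proof -
    have "(norm (norm u, norm E))\<^sup>2 \<le> (norm (upper w /// upper (lower w) /// lower (lower w)))\<^sup>2"
      unfolding norm_stack by (simp add: E_def u_def norm_Pair)
    then show ?thesis
      unfolding stack_upper_lower by (rule power2_le_imp_le) simp
  qed
  finally have *: "norm (inverse \<theta> *\<^sub>R u - E *v y) \<le> norm (inverse \<theta>, norm y) * norm w"
    by (simp add: mult_left_mono)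
  have "norm (quadratic_remainder p q \<theta> y w) \<le> norm E * norm (inverse \<theta> *\<^sub>R u - E *v y)"
    using norm_vector_matrix_mult_le[of "Sigma_pq p q *v (inverse \<theta> *\<^sub>R u - E *v y)" E] assms
    by (simp add: quadratic_remainder_def Let_def E_def u_def norm_Sigma_pq_mult)
  also have "\<dots> \<le> norm w * (norm (inverse \<theta>, norm y) * norm w)"
    using * by (intro mult_mono) (auto simp: E_def norm_upper_le)
  finally show ?thesis
    using assms(2) by (simp add: norm_Pair power2_eq_square ac_simps)
qed

lemma continuous_on_quadratic_remainder:
  fixes S :: "(real^(('n::finite \<times> 'm::{finite,linorder}) + 'm + 'k::finite)) set"
  shows "continuous_on S (quadratic_remainder p q \<theta> y)"
  unfolding quadratic_remainder_def Let_def by (intro continuous_intros)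

text \<open>Hypothesis \<open>t\<close> keeps the ball of radius \<open>t\<close> invariant under w
  |-> J^+ (h - N w): the part J^+ h has norm \<open>rho_at\<close>, and the uniform bound by
  \<open>tau0_ILSE\<close> controls J^+ N w.\<close>

lemma mu_ILSE_le_if_ball_invariant:
  fixes A :: "real^'n^('m::{finite,linorder})" and b :: "real^('m::_)"
    and B :: "real^'n^'s" and d :: "real^'s"
  assumes "p + q = CARD('m)" and pos: "\<theta>1 > 0" "\<theta>2 > 0" "\<theta>3 > 0" and "b - A *v y \<noteq> 0"
    and "t > 0"
    and t: "rho_at p q \<theta>1 \<theta>2 \<theta>3 A b B d y \<xi>
      + tau0_ILSE TYPE('s) p q \<theta>1 \<theta>3 A b y * sqrt ((inverse \<theta>1)\<^sup>2 + (norm y)\<^sup>2) * t\<^sup>2 \<le> t"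
  shows "mu_ILSE p q \<theta>1 \<theta>2 \<theta>3 A b B d y \<le> t"
proof -
  define J where "J = J_ILSE p q \<theta>1 \<theta>2 \<theta>3 A b y \<xi>"
  define h where
    "h = (transpose B *v \<xi> - transpose A *v (Sigma_pq p q *v (b - A *v y))) /// (d - B *v y)"
  define N :: "real^(('n \<times> 'm) + 'm + ('n \<times> 's) + 's) \<Rightarrow> real^('n + 's)"
    where "N w = quadratic_remainder p q \<theta>1 y w /// 0" for w
  define \<tau> where "\<tau> = tau0_ILSE TYPE('s) p q \<theta>1 \<theta>3 A b y"
  define \<kappa> where "\<kappa> = sqrt ((inverse \<theta>1)\<^sup>2 + (norm y)\<^sup>2)"
  have "\<tau> \<ge> 0"
    unfolding \<tau>_def tau0_ILSE_def by (rule onorm_pos_le) simp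
  have "\<kappa> \<ge> 0"
    by (simp add: \<kappa>_def)
  obtain w where w: "w \<in> cball 0 t" "pinv J *v (h - N w) = w"
  proof (rule brouwer_ball[OF \<open>t > 0\<close>, of 0 "\<lambda>w. pinv J *v (h - N w)"])
    show "continuous_on (cball 0 t) (\<lambda>w. pinv J *v (h - N w))"
      unfolding N_def by (intro continuous_intros continuous_on_quadratic_remainder)
    show "(\<lambda>w. pinv J *v (h - N w)) \<in> cball 0 t \<rightarrow> cball 0 t"
    proof
      fix w assume "w \<in> cball (0 :: real^(('n \<times> 'm) + 'm + ('n \<times> 's) + 's)) t"
      then have "(norm w)\<^sup>2 \<le> t\<^sup>2"
        by (simp add: power_mono)
      have "(norm (N w))\<^sup>2 = (norm (quadratic_remainder p q \<theta>1 y w))\<^sup>2"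
        unfolding N_def norm_stack by simp
      then have "norm (N w) \<le> \<kappa> * (norm w)\<^sup>2"
        using norm_quadratic_remainder_le[of p q \<theta>1 y w] assms by (simp add: \<kappa>_def)
      also have "\<dots> \<le> \<kappa> * t\<^sup>2"
        using \<open>(norm w)\<^sup>2 \<le> t\<^sup>2\<close> \<open>\<kappa> \<ge> 0\<close> by (rule mult_left_mono)
      finally have N: "norm (N w) \<le> \<kappa> * t\<^sup>2" .
      have "norm (pinv J *v (h - N w)) \<le> norm (pinv J *v h) + norm (pinv J *v N w)"
        by (simp add: matrix_vector_mult_diff_distrib norm_triangle_ineq4)
      also have "norm (pinv J *v N w) \<le> \<tau> * norm (N w)"
        unfolding J_def \<tau>_def by (intro norm_pinv_J_ILSE_le assms)
      also have "\<tau> * norm (N w) \<le> \<tau> * (\<kappa> * t\<^sup>2)"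
        using N \<open>\<tau> \<ge> 0\<close> by (rule mult_left_mono)
      also have "norm (pinv J *v h) + \<tau> * (\<kappa> * t\<^sup>2) \<le> t"
        using t by (simp add: rho_at_def J_def h_def \<tau>_def \<kappa>_def mult.assoc)
      finally show "pinv J *v (h - N w) \<in> cball 0 t"
        by simp
    qed
  qed
  \<comment> \<open>Since J is onto, J J^+ is the identity, so applying J to the fixed-point
    equation yields the exact system.\<close>
  have "J *v (pinv J *v (h - N w)) = h - N w"
    unfolding J_def by (intro mult_pinv_mult surj_J_ILSE assms)
  then have "J *v w = h - N w"
    by (simp add: w(2))
  then have "mu_ILSE p q \<theta>1 \<theta>2 \<theta>3 A b B d y \<le> norm w"
    using pos by (intro mu_ILSE_le[where \<xi> = \<xi>]) (auto simp: J_def h_def N_def)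
  with w(1) show ?thesis
    by simp
qed


subsection \<open>Positivity of the linearised estimate\<close>

text \<open>For feasible \<open>z\<close> the difference x = z - y lies in the null space of
  \<open>B\<close>. The first-order term vanishes because (S r) . (A x) = \<xi> . (B x) = 0, and
  what remains is the nonnegative quadratic form.\<close>

lemma is_ilse_solutionI:
  assumes "ilse_normal_equations p q A b B d y \<xi>"
    and "\<And>x. B *v x = 0 \<Longrightarrow> 0 \<le> x \<bullet> ((transpose A ** Sigma_pq p q ** A) *v x)"
  shows "is_ilse_solution p q A b B d y"
proof -
  have "ilse_objective p q A b y \<le> ilse_objective p q A b z" if "B *v z = d" for z
  proof -
    define x where "x = z - y"
    define r where "r = b - A *v y"
    have "B *v x = 0"
      using assms(1) that by (simp add: x_def ilse_normal_equations_def matrix_vector_mult_diff_distrib)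
    have "(Sigma_pq p q *v r) \<bullet> (A *v x) = (transpose A *v (Sigma_pq p q *v r)) \<bullet> x"
      by (simp add: dot_lmul_matrix)
    also have "\<dots> = \<xi> \<bullet> (B *v x)"
      using assms(1) unfolding ilse_normal_equations_def r_def by (simp add: dot_lmul_matrix)
    finally have orth: "(Sigma_pq p q *v r) \<bullet> (A *v x) = 0"
      by (simp add: \<open>B *v x = 0\<close>)
    have "x \<bullet> ((transpose A ** Sigma_pq p q ** A) *v x) =
        x \<bullet> (transpose A *v (Sigma_pq p q *v (A *v x)))"
      by (simp only: matrix_vector_mul_assoc matrix_mul_assoc)
    also have "\<dots> = (A *v x) \<bullet> (Sigma_pq p q *v (A *v x))"
      by (metis dot_lmul_matrix inner_commute transpose_matrix_vector)
    finally have "0 \<le> (A *v x) \<bullet> (Sigma_pq p q *v (A *v x))"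
      using assms(2)[OF \<open>B *v x = 0\<close>] by linarith
    moreover have "r \<bullet> (Sigma_pq p q *v (A *v x)) = 0" "(A *v x) \<bullet> (Sigma_pq p q *v r) = 0"
      using orth inner_Sigma_pq_commute[of r p q "A *v x"] by (simp_all add: inner_commute)
    moreover have "b - A *v z = r - A *v x"
      by (simp add: x_def r_def matrix_vector_mult_diff_distrib)
    ultimately show ?thesis
      unfolding ilse_objective_def r_def[symmetric]
      by (simp add: matrix_vector_mult_diff_distrib inner_diff_left inner_diff_right)
  qed
  with assms(1) show ?thesis
    by (simp add: is_ilse_solution_def ilse_normal_equations_def)
qed

text \<open>Injectivity bounds the \<open>\<xi>\<close>, which need not be bounded a priori; hence \<open>G *v \<xi>\<close> tends to
  zero.\<close>

lemma mem_range_if_perturbations: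
  fixes M :: "real^'s^'n"
  assumes "inj ((*v) M)"
    and approx: "\<And>\<epsilon>. \<epsilon> > 0 \<Longrightarrow> \<exists>\<xi> e G. norm e \<le> \<epsilon> \<and> norm G \<le> \<epsilon> \<and> M *v \<xi> = c + e + G *v \<xi>"
  shows "c \<in> range ((*v) M)"
proof -
  obtain m where m: "m > 0" "\<And>x. m * norm x \<le> norm (M *v x)"
    using linear_inj_bounded_below_pos[OF matrix_vector_mul_linear assms(1)] by blast
  \<comment> \<open>Bounds |\<xi>|, by solving m |\<xi>| <= |c| + 1 + (m / 2) |\<xi>|.\<close>
  define K where "K = 2 * (norm c + 1) / m"
  have "K \<ge> 0"
    using m by (simp add: K_def)
  have "c \<in> closure (range ((*v) M))"
    unfolding closure_approachable
  proof (intro allI impI)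
    fix \<delta> :: real assume "\<delta> > 0"
    \<comment> \<open>The bound 1 controls \<open>e\<close>, the bound m / 2 lets G \<xi> be
      absorbed into the left-hand side, and the last one makes \<epsilon> (1 + K) at most \<delta> /
      2.\<close>
    define \<epsilon> where "\<epsilon> = min (min 1 (m / 2)) (\<delta> / (2 * (1 + K)))"
    have "\<epsilon> > 0"
      using \<open>\<delta> > 0\<close> m \<open>K \<ge> 0\<close> by (simp add: \<epsilon>_def)
    then obtain \<xi> e G where *: "norm e \<le> \<epsilon>" "norm G \<le> \<epsilon>" "M *v \<xi> = c + e + G *v \<xi>"
      using approx by blast
    have G: "norm (G *v \<xi>) \<le> \<epsilon> * norm \<xi>"
      using norm_matrix_vector_mult_le[of G \<xi>] *(2) by (meson mult_right_mono norm_ge_zero order_trans)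
    have "m * norm \<xi> \<le> norm c + norm e + norm (G *v \<xi>)"
      using m(2)[of \<xi>] norm_triangle_ineq[of "c + e" "G *v \<xi>"] norm_triangle_ineq[of c e]
      by (simp add: *(3))
    also have "\<dots> \<le> norm c + 1 + m / 2 * norm \<xi>"
    proof -
      have "\<epsilon> \<le> 1" "\<epsilon> \<le> m / 2"
        unfolding \<epsilon>_def by linarith+
      then show ?thesis
        using G *(1) mult_right_mono[of \<epsilon> "m / 2" "norm \<xi>"] by simp
    qed
    finally have "norm \<xi> \<le> K"
      using m by (simp add: K_def field_simps)
    have "norm (M *v \<xi> - c) \<le> norm e + norm (G *v \<xi>)"
      using norm_triangle_ineq[of e "G *v \<xi>"] by (simp add: *(3))
    also have "\<dots> \<le> \<epsilon> + \<epsilon> * K"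
      using *(1) G mult_left_mono[OF \<open>norm \<xi> \<le> K\<close>, of \<epsilon>] \<open>\<epsilon> > 0\<close> by linarith
    also have "\<dots> = \<epsilon> * (1 + K)"
      by (simp add: algebra_simps)
    also have "\<dots> \<le> \<delta> / (2 * (1 + K)) * (1 + K)"
      using \<open>K \<ge> 0\<close> by (intro mult_right_mono) (auto simp: \<epsilon>_def)
    also have "\<dots> < \<delta>"
      using \<open>K \<ge> 0\<close> \<open>\<delta> > 0\<close> by (simp add: field_simps add_pos_nonneg)
    finally show "\<exists>z\<in>range ((*v) M). dist z c < \<delta>"
      by (auto simp: dist_norm)
  qed
  moreover have "closed (range ((*v) M))"
    by (intro closed_subspace linear_subspace_image) auto
  ultimately show ?thesis
    by simp
qed

lemma bdd_below_rho_at: "bdd_below (range (rho_at p q \<theta>1 \<theta>2 \<theta>3 A b B d y))"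
  by (intro bdd_belowI2[where m = 0]) (simp add: rho_at_def)

lemma rho_ILSE_less_iff:
  "rho_ILSE p q \<theta>1 \<theta>2 \<theta>3 A b B d y < \<epsilon> \<longleftrightarrow> (\<exists>\<xi>. rho_at p q \<theta>1 \<theta>2 \<theta>3 A b B d y \<xi> < \<epsilon>)"
  unfolding rho_ILSE_def by (simp add: cINF_less_iff bdd_below_rho_at)

text \<open>A vanishing infimum gives, for each \<epsilon>, some \<xi> with J^+ h small, hence
  normal equations that hold up to small errors. No bound on these \<xi> is known beforehand, so the
  error multiplying \<xi> is kept apart as a small matrix.\<close>

lemma rho_ILSE_pos:
  fixes A :: "real^'n^('m::{finite,linorder})" and b :: "real^('m::_)"
    and B :: "real^'n^'s" and d :: "real^'s"
  assumes pq: "p + q = CARD('m)" and "rank B = CARD('s)"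
    and psd: "\<And>x. B *v x = 0 \<Longrightarrow> 0 \<le> x \<bullet> ((transpose A ** Sigma_pq p q ** A) *v x)"
    and pos: "\<theta>1 > 0" "\<theta>2 > 0" "\<theta>3 > 0"
    and "\<not> is_ilse_solution p q A b B d y"
    and "b - A *v y \<noteq> 0"
  shows "rho_ILSE p q \<theta>1 \<theta>2 \<theta>3 A b B d y > 0"
proof (rule ccontr)
  assume neg: "\<not> ?thesis"
  define S where "S = (Sigma_pq p q :: real^('m::_)^('m::_))"
  define r where "r = b - A *v y"
  have norm_S: "norm (S *v x) = norm x" for x
    unfolding S_def by (rule norm_Sigma_pq_mult[OF pq])
  \<comment> \<open>Collects every coefficient of \<open>norm w\<close> in the three error bounds
    below; the summand 1 makes it positive.\<close>
  define K where "K = 1 + norm r + norm A * norm y + inverse \<theta>1 * norm A + inverse \<theta>2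
    + inverse \<theta>2 * norm y + inverse \<theta>3"
  have "K > 0"
    using pos unfolding K_def by (simp add: add_pos_nonneg)
  have approx: "norm (d - B *v y) \<le> \<epsilon> \<and> (\<exists>\<xi> e G. norm e \<le> \<epsilon> \<and> norm G \<le> \<epsilon> \<and>
      transpose B *v \<xi> = (S *v r) v* A + e + G *v \<xi>)" if "\<epsilon> > 0" for \<epsilon>
  proof -
    have "rho_ILSE p q \<theta>1 \<theta>2 \<theta>3 A b B d y < \<epsilon> / K"
      using neg \<open>\<epsilon> > 0\<close> \<open>K > 0\<close> by (meson divide_pos_pos not_less order_le_less_trans)
    then obtain \<xi> where \<xi>: "rho_at p q \<theta>1 \<theta>2 \<theta>3 A b B d y \<xi> < \<epsilon> / K"
      unfolding rho_ILSE_less_iff by blast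
    define J where "J = J_ILSE p q \<theta>1 \<theta>2 \<theta>3 A b y \<xi>"
    define h where "h = (transpose B *v \<xi> - transpose A *v (S *v r)) /// (d - B *v y)"
    define w where "w = pinv J *v h"
    define E where "E = unvectorize (upper w)"
    define u where "u = upper (lower w)"
    define F where "F = unvectorize (upper (lower (lower w)))"
    define v where "v = lower (lower (lower w))"
    have "norm w < \<epsilon> / K"
      using \<xi> by (simp add: w_def J_def h_def rho_at_def S_def r_def)
    then have w: "norm w * K \<le> \<epsilon>"
      using \<open>K > 0\<close> by (simp add: field_simps)
    have le: "norm E \<le> norm w" "norm u \<le> norm w" "norm F \<le> norm w" "norm v \<le> norm w"
      unfolding E_def u_def F_def v_def norm_unvectorize
      by (meson norm_upper_le norm_lower_le order_trans)+
    have Jw: "J *v w = h"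
      unfolding w_def J_def by (intro mult_pinv_mult surj_J_ILSE assms)
    \<comment> \<open>The first block row of J w = h is solved for B^T \<xi>: \<open>e\<close>
      gathers the terms free of \<xi>, and \<open>G\<close> is the matrix acting on \<xi>.\<close>
    define e where "e = (S *v r) v* E - (S *v (E *v y)) v* A + inverse \<theta>1 *\<^sub>R ((S *v u) v* A)"
    define G where "G = - (inverse \<theta>2 *\<^sub>R transpose F)"
    have "e - inverse \<theta>2 *\<^sub>R (\<xi> v* F) = \<xi> v* B - (S *v r) v* A"
      using arg_cong[OF Jw, of upper]
      by (simp add: J_def J_ILSE_mult Let_def h_def e_def E_def u_def F_def S_def r_def)
    then have "transpose B *v \<xi> = (S *v r) v* A + e + G *v \<xi>"
      by (simp add: G_def matrix_uminus_mult scaleR_matrix_vector_assoc[symmetric] algebra_simps)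
    moreover have "norm e \<le> \<epsilon>"
    proof -
      have "norm ((S *v r) v* E) \<le> norm r * norm w"
        using norm_vector_matrix_mult_le[of "S *v r" E] le(1)
        by (smt (verit) mult.commute mult_left_mono norm_S norm_ge_zero)
      moreover have "norm ((S *v (E *v y)) v* A) \<le> norm A * norm y * norm w"
      proof -
        have "norm ((S *v (E *v y)) v* A) \<le> norm A * norm (E *v y)"
          using norm_vector_matrix_mult_le[of "S *v (E *v y)" A] by (simp add: norm_S)
        also have "\<dots> \<le> norm A * (norm w * norm y)"
          using norm_matrix_vector_mult_le[of E y] le(1)
          by (intro mult_left_mono norm_ge_zero) (meson mult_right_mono norm_ge_zero order_trans)
        finally show ?thesis
          by (simp add: ac_simps)
      qed
      moreover have "norm (inverse \<theta>1 *\<^sub>R ((S *v u) v* A)) \<le> inverse \<theta>1 * norm A * norm w"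
      proof -
        have "norm ((S *v u) v* A) \<le> norm A * norm u"
          using norm_vector_matrix_mult_le[of "S *v u" A] by (simp add: norm_S)
        also have "\<dots> \<le> norm A * norm w"
          using le(2) by (simp add: mult_left_mono)
        finally show ?thesis
          using pos by (simp add: mult_left_mono)
      qed
      ultimately have "norm e \<le> norm w * (norm r + norm A * norm y + inverse \<theta>1 * norm A)"
        using norm_triangle_ineq4[of "(S *v r) v* E" "(S *v (E *v y)) v* A"]
          norm_triangle_ineq[of "(S *v r) v* E - (S *v (E *v y)) v* A"
            "inverse \<theta>1 *\<^sub>R ((S *v u) v* A)"]
        unfolding e_def distrib_left by (simp add: mult.commute)
      also have "\<dots> \<le> norm w * K"
        using pos by (intro mult_left_mono) (auto simp: K_def)
      finally show ?thesis
        using w by simp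
    qed
    moreover have "norm G \<le> \<epsilon>"
    proof -
      have "norm G \<le> norm w * inverse \<theta>2"
        using le(3) pos by (simp add: G_def norm_transpose divide_right_mono field_simps)
      also have "\<dots> \<le> norm w * K"
        using pos by (intro mult_left_mono) (auto simp: K_def)
      finally show ?thesis
        using w by simp
    qed
    moreover have "norm (d - B *v y) \<le> \<epsilon>"
    proof -
      have "norm (F *v y) \<le> norm w * norm y"
        using norm_matrix_vector_mult_le[of F y] le(3)
        by (meson mult_right_mono norm_ge_zero order_trans)
      then have "inverse \<theta>2 * norm (F *v y) \<le> inverse \<theta>2 * (norm w * norm y)"
        using pos by (intro mult_left_mono) auto
      moreover have "norm (d - B *v y) \<le> inverse \<theta>2 * norm (F *v y) + inverse \<theta>3 * norm v"
      proof -
        have "d - B *v y = inverse \<theta>2 *\<^sub>R (F *v y) - inverse \<theta>3 *\<^sub>R v"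
          using arg_cong[OF Jw, of lower]
          by (simp add: J_def J_ILSE_mult Let_def h_def F_def v_def)
        then show ?thesis
          using norm_triangle_ineq4[of "inverse \<theta>2 *\<^sub>R (F *v y)" "inverse \<theta>3 *\<^sub>R v"] pos by simp
      qed
      moreover have "inverse \<theta>3 * norm v \<le> inverse \<theta>3 * norm w"
        using pos le(4) by (intro mult_left_mono) auto
      ultimately have "norm (d - B *v y) \<le> inverse \<theta>2 * (norm w * norm y) + inverse \<theta>3 * norm w"
        by linarith
      also have "\<dots> = norm w * (inverse \<theta>2 * norm y + inverse \<theta>3)"
        by (simp add: algebra_simps)
      also have "\<dots> \<le> norm w * K"
        using pos by (intro mult_left_mono) (auto simp: K_def)
      finally show ?thesis
        using w by simp
    qed
    ultimately show ?thesis
      by blast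
  qed
  have "norm (d - B *v y) \<le> 0"
    by (rule field_le_epsilon) (use approx in simp)
  then have "B *v y = d"
    by simp
  \<comment> \<open>Full row rank of \<open>B\<close> is what controls the size of the multipliers
    as \<epsilon> shrinks.\<close>
  moreover have "inj ((*v) (transpose B))"
    using assms(2) by (simp add: full_rank_injective[symmetric] rank_transpose del: transpose_matrix_vector)
  then have "(S *v r) v* A \<in> range ((*v) (transpose B))"
    by (rule mem_range_if_perturbations) (use approx in blast)
  then obtain \<xi> where "(S *v r) v* A = transpose B *v \<xi>"
    by blast
  ultimately have "ilse_normal_equations p q A b B d y \<xi>"
    by (simp add: ilse_normal_equations_def S_def r_def)
  then have "is_ilse_solution p q A b B d y"
    using psd by (rule is_ilse_solutionI)
  with assms(7) show False
    by contradiction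
qed

section \<open>Choice of the radius and the strict bound\<close>

theorem theorem2p1:
  fixes A :: "real^'n^('m::{finite,linorder})" and b :: "real^('m::_)"
    and B :: "real^'n^'s" and d :: "real^'s"
    and y :: "real^'n" and p q :: nat and \<theta>1 \<theta>2 \<theta>3 :: real
  assumes "CARD('n) \<le> CARD('m)" and "p + q = CARD('m)"
    and "rank B = CARD('s)"
    and "\<And>x. B *v x = 0 \<Longrightarrow> x \<noteq> 0 \<Longrightarrow>
           x \<bullet> ((transpose A ** Sigma_pq p q ** A) *v x) > 0"
    and "\<theta>1 > 0" and "\<theta>2 > 0" and "\<theta>3 > 0"
    and "\<not> is_ilse_solution p q A b B d y"
    and "b - A *v y \<noteq> 0"
    and "4 * tau0_ILSE TYPE('s) p q \<theta>1 \<theta>3 A b y * rho_ILSE p q \<theta>1 \<theta>2 \<theta>3 A b B d y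
           * sqrt (inverse \<theta>1 ^ 2 + norm y ^ 2) < 1"
  shows "mu_ILSE p q \<theta>1 \<theta>2 \<theta>3 A b B d y < 2 * rho_ILSE p q \<theta>1 \<theta>2 \<theta>3 A b B d y"
proof -
  define \<rho> where "\<rho> = rho_ILSE p q \<theta>1 \<theta>2 \<theta>3 A b B d y"
  define c where "c = tau0_ILSE TYPE('s) p q \<theta>1 \<theta>3 A b y * sqrt ((inverse \<theta>1)\<^sup>2 + (norm y)\<^sup>2)"
  have "0 \<le> x \<bullet> ((transpose A ** Sigma_pq p q ** A) *v x)" if "B *v x = 0" for x
    using assms(4)[OF that] by (cases "x = 0") auto
  then have "\<rho> > 0"
    unfolding \<rho>_def by (intro rho_ILSE_pos assms)
  have "tau0_ILSE TYPE('s) p q \<theta>1 \<theta>3 A b y \<ge> 0"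
    unfolding tau0_ILSE_def by (rule onorm_pos_le) simp
  then have "c \<ge> 0"
    by (simp add: c_def)
  have "4 * c * \<rho> < 1"
    using assms(10) by (simp add: c_def \<rho>_def ac_simps)
  text \<open>The infimum \<open>\<rho>\<close> need not be attained, so some slack \<open>\<delta>\<close> is split between the choice of
    \<open>\<xi>\<close> and the radius \<open>2 * \<rho> - \<delta>\<close>.\<close>
  define \<delta> where "\<delta> = \<rho> * (1 - 4 * c * \<rho>) / 2"
  have "\<delta> > 0"
    using \<open>\<rho> > 0\<close> \<open>4 * c * \<rho> < 1\<close> by (simp add: \<delta>_def)
  \<comment> \<open>Keeps the radius \<open>2 * \<rho> - \<delta>\<close> positive, so that its
    square is at most that of \<open>2 * \<rho>\<close>.\<close>
  have "\<delta> \<le> \<rho>"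
  proof -
    have "0 \<le> 4 * c * \<rho>"
      using \<open>\<rho> > 0\<close> \<open>c \<ge> 0\<close> by simp
    then have "\<rho> * (1 - 4 * c * \<rho>) \<le> \<rho> * 1"
      using \<open>\<rho> > 0\<close> by (intro mult_left_mono) linarith+
    then show ?thesis
      using \<open>\<rho> > 0\<close> unfolding \<delta>_def by linarith
  qed
  obtain \<xi> where \<xi>: "rho_at p q \<theta>1 \<theta>2 \<theta>3 A b B d y \<xi> < \<rho> + \<delta>"
    using rho_ILSE_less_iff[of p q \<theta>1 \<theta>2 \<theta>3 A b B d y "\<rho> + \<delta>"] \<open>\<delta> > 0\<close> by (auto simp: \<rho>_def)
  have "c * (2 * \<rho> - \<delta>)\<^sup>2 \<le> c * (2 * \<rho>)\<^sup>2"
    using \<open>c \<ge> 0\<close> \<open>\<delta> \<le> \<rho>\<close> \<open>\<delta> > 0\<close> \<open>\<rho> > 0\<close> by (intro mult_left_mono power_mono) auto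
  \<comment> \<open>The value of \<delta> is chosen for this identity: adding the bound \<rho> +
    \<delta> on \<open>rho_at\<close> gives exactly the radius 2 \<rho> - \<delta>.\<close>
  also have "\<dots> = \<rho> - 2 * \<delta>"
    by (simp add: \<delta>_def power2_eq_square field_simps)
  finally have "rho_at p q \<theta>1 \<theta>2 \<theta>3 A b B d y \<xi> + c * (2 * \<rho> - \<delta>)\<^sup>2 \<le> 2 * \<rho> - \<delta>"
    using \<xi> by simp
  moreover have "2 * \<rho> - \<delta> > 0"
    using \<open>\<delta> \<le> \<rho>\<close> \<open>\<rho> > 0\<close> by simp
  ultimately have "mu_ILSE p q \<theta>1 \<theta>2 \<theta>3 A b B d y \<le> 2 * \<rho> - \<delta>"
    unfolding c_def by (intro mu_ILSE_le_if_ball_invariant assms)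
  with \<open>\<delta> > 0\<close> show ?thesis
    by (simp add: \<rho>_def)
qed

end
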